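(* Assume $$\int_0^{\Phi_F}\frac1{K(\phi)}\,d\phi\le1 .$$ Then every classical solution of system (S) blows up in finite time. Furthermore, its maximal existence time $\tau^*$ satisfies $$\tau^*\le\int_0^{\Phi_F}\frac1{K(\phi)}\,d\phi\le1<\infty .$$
   Context: Standing assumptions: $\Phi_F>0$ is fixed and $K\in C^2(\mathbb{R})$ is a function with $K',K''$ bounded on $\mathbb{R}$ and $K(\phi)>0$ for $\phi\in[0,\Phi_F]$. System (S), for unknowns $Q(\tau,\eta)$ and $N(\tau)$: $$\partial_\tau Q+\partial_\eta Q=\frac1{N(\tau)}+K(Q)\quad(\tau>0,\ \eta\in(0,1)),\qquad Q(\tau,0)=0\quad(\tau>0),$$ $$\frac1{N(\tau)}=\partial_\eta Q(\tau,1)-K(\Phi_F)\quad(\tau>0),\qquad Q(0,\eta)=Q_{\mathrm{init}}(\eta)\quad(\eta\in[0,1]).$$ Classical solution: given $0<T\le+\infty$ and an initial datum $Q_{\mathrm{init}}\in C^1[0,1]$ that is increasing with $Q_{\mathrm{init}}(0)=0$, $Q_{\mathrm{init}}(1)=\Phi_F$ and $\frac{d}{d\eta}Q_{\mathrm{init}}(1)>K(\Phi_F)$, a pair $(Q,N)$ is a classical solution of (S) on $[0,T)$ if (1) $Q\in C^1([0,T)\times[0,1])$ is increasing in $\eta$ and $N\in C[0,T)$ is positive; (2) the equations of (S) hold in the classical sense for $\tau\in[0,T)$; (3) $K(\Phi_F)<\partial_\eta Q(\tau,1)<+\infty$ for all $\tau\in[0,T)$. Here "increasing" means non-decreasing.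 Each classical solution is considered on its maximal existence interval $[0,\tau^* )$, where the maximal existence time $\tau^*$ is the supremum of all $T$ for which a classical solution on $[0,T)$ with the given initial datum exists. It "blows up in finite time" if $\tau^*<+\infty$ (in which case $N(\tau)\to+\infty$ as $\tau\to(\tau^* )^-$). *)

theory Defs
  imports "HOL-Analysis.Analysis"
begin

definition C2_bounded_derivs :: "(real \<Rightarrow> real) \<Rightarrow> bool" where
  "C2_bounded_derivs K \<longleftrightarrow>
     K differentiable_on UNIV \<and> deriv K differentiable_on UNIV \<and>
     continuous_on UNIV (deriv (deriv K)) \<and>
     bounded (range (deriv K)) \<and> bounded (range (deriv (deriv K)))"

text \<open>Derivatives at boundary points of \<open>[0,\<infinity>)\<close> and \<open>[0,1]\<close> are one-sided.\<close>

definition d_tau :: "(real \<Rightarrow> real \<Rightarrow> real) \<Rightarrow> real \<Rightarrow> real \<Rightarrow> real" where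
  "d_tau Q \<tau> \<eta> = vector_derivative (\<lambda>s. Q s \<eta>) (at \<tau> within {0..})"

definition d_eta :: "(real \<Rightarrow> real \<Rightarrow> real) \<Rightarrow> real \<Rightarrow> real \<Rightarrow> real" where
  "d_eta Q \<tau> \<eta> = vector_derivative (Q \<tau>) (at \<eta> within {0..1})"

text \<open>The half-open time interval \<open>[0,T)\<close>, where \<open>T\<close> may be \<open>\<infinity>\<close>.\<close>

definition time_interval :: "ereal \<Rightarrow> real set" where
  "time_interval T = {\<tau>. 0 \<le> \<tau> \<and> ereal \<tau> < T}"

text \<open>\<open>C\<^sup>1([0,T) \<times> [0,1])\<close>: both partial derivatives exist and are continuous up to the
  boundary.  The differentiability clauses are needed because \<^const>\<open>vector_derivative\<close> is an
  arbitrary value where no derivative exists.\<close>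

definition C1_strip :: "ereal \<Rightarrow> (real \<Rightarrow> real \<Rightarrow> real) \<Rightarrow> bool" where
  "C1_strip T Q \<longleftrightarrow>
     continuous_on (time_interval T \<times> {0..1}) (\<lambda>(\<tau>, \<eta>). Q \<tau> \<eta>) \<and>
     (\<forall>\<tau>\<in>time_interval T. \<forall>\<eta>\<in>{0..1}.
        (\<lambda>s. Q s \<eta>) differentiable (at \<tau> within {0..}) \<and>
        Q \<tau> differentiable (at \<eta> within {0..1})) \<and>
     continuous_on (time_interval T \<times> {0..1}) (\<lambda>(\<tau>, \<eta>). d_tau Q \<tau> \<eta>) \<and>
     continuous_on (time_interval T \<times> {0..1}) (\<lambda>(\<tau>, \<eta>). d_eta Q \<tau> \<eta>)"

definition initial_datum :: "(real \<Rightarrow> real) \<Rightarrow> real \<Rightarrow> (real \<Rightarrow> real) \<Rightarrow> bool" where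
  "initial_datum K \<Phi>\<^sub>F Q\<^sub>i \<longleftrightarrow>
     Q\<^sub>i differentiable_on {0..1} \<and>
     continuous_on {0..1} (\<lambda>\<eta>. vector_derivative Q\<^sub>i (at \<eta> within {0..1})) \<and>
     mono_on {0..1} Q\<^sub>i \<and> Q\<^sub>i 0 = 0 \<and> Q\<^sub>i 1 = \<Phi>\<^sub>F \<and>
     vector_derivative Q\<^sub>i (at 1 within {0..1}) > K \<Phi>\<^sub>F"

text \<open>The bound \<open>\<partial>\<^sub>\<eta>Q(\<tau>,1) < +\<infinity>\<close> holds automatically, as
  \<^const>\<open>d_eta\<close> is real-valued.\<close>

definition classical_solution ::
  "(real \<Rightarrow> real) \<Rightarrow> real \<Rightarrow> (real \<Rightarrow> real) \<Rightarrow> ereal \<Rightarrow>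
     (real \<Rightarrow> real \<Rightarrow> real) \<Rightarrow> (real \<Rightarrow> real) \<Rightarrow> bool" where
  "classical_solution K \<Phi>\<^sub>F Q\<^sub>i T Q N \<longleftrightarrow>
     0 < T \<and>
     C1_strip T Q \<and> (\<forall>\<tau>\<in>time_interval T. mono_on {0..1} (Q \<tau>)) \<and>
     continuous_on (time_interval T) N \<and> (\<forall>\<tau>\<in>time_interval T. 0 < N \<tau>) \<and>
     (\<forall>\<tau>\<in>time_interval T. 0 < \<tau> \<longrightarrow>
        (\<forall>\<eta>\<in>{0<..<1}. d_tau Q \<tau> \<eta> + d_eta Q \<tau> \<eta> = 1 / N \<tau> + K (Q \<tau> \<eta>)) \<and>
        Q \<tau> 0 = 0 \<and>
        1 / N \<tau> = d_eta Q \<tau> 1 - K \<Phi>\<^sub>F) \<and>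
     (\<forall>\<eta>\<in>{0..1}. Q 0 \<eta> = Q\<^sub>i \<eta>) \<and>
     (\<forall>\<tau>\<in>time_interval T. K \<Phi>\<^sub>F < d_eta Q \<tau> 1)"

definition max_existence_time ::
  "(real \<Rightarrow> real) \<Rightarrow> real \<Rightarrow> (real \<Rightarrow> real) \<Rightarrow> ereal" where
  "max_existence_time K \<Phi>\<^sub>F Q\<^sub>i = Sup {T. \<exists>Q N. classical_solution K \<Phi>\<^sub>F Q\<^sub>i T Q N}"

text \<open>The maximal existence time, hence also blow-up, depends on a solution only through its
  initial datum.\<close>

definition blows_up_in_finite_time ::
  "(real \<Rightarrow> real) \<Rightarrow> real \<Rightarrow> (real \<Rightarrow> real) \<Rightarrow> bool" where
  "blows_up_in_finite_time K \<Phi>\<^sub>F Q\<^sub>i \<longleftrightarrow> max_existence_time K \<Phi>\<^sub>F Q\<^sub>i < \<infinity>"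

end

theory Submission
  imports Defs
begin

text \<open>
  The right end of the strip stays pinned at the threshold, \<open>Q(\<tau>,1) = \<Phi>\<^sub>F\<close>, and
  \<open>Q(\<tau>,0) = 0\<close>, so by monotonicity in \<open>\<eta>\<close> every value of \<open>Q\<close> lies in \<open>[0,\<Phi>\<^sub>F]\<close>.  Along the
  characteristic \<open>q(t) = Q(t,t)\<close> issuing from the corner \<open>(0,0)\<close> the system reads
  \<open>q' = 1/N + K(q) > K(q)\<close>.  A particle driven at speed exactly \<open>K\<close> needs time
  \<open>m\<close>, the integral of \<open>1/K\<close> over \<open>[0,\<Phi>\<^sub>F]\<close>, to travel from \<open>0\<close> to \<open>\<Phi>\<^sub>F\<close>; driven strictly faster, it overshoots
  \<open>\<Phi>\<^sub>F\<close> by time \<open>m\<close>.  Since \<open>m \<le> 1\<close>, the characteristic is still inside the strip at time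
  \<open>m\<close>, where \<open>q \<le> \<Phi>\<^sub>F\<close>.  Hence no solution survives up to and including time \<open>m\<close>
  (\<open>existence_time_le\<close>).

  Three facts carry this: a Gronwall uniqueness argument for the pinning at \<open>\<eta> = 1\<close>
  (\<open>solution_right_boundary\<close>), the chain rule along the diagonal
  (\<open>solution_characteristic_derivative\<close>), and the travel-time comparison
  (\<open>travel_time_less\<close>).
\<close>

section \<open>Real analysis in one and two variables\<close>

text \<open>Gronwall's argument: \<open>u\<^sup>2 exp (-2Lt)\<close> is nonnegative, starts at zero and cannot
  increase.\<close>

lemma eq_zero_if_deriv_le_linear:
  fixes u :: "real \<Rightarrow> real"
  assumes "0 \<le> c" and cont: "continuous_on {0..c} u" and "u 0 = 0"
    and deriv: "\<And>t. 0 < t \<Longrightarrow> t < c \<Longrightarrow> (u has_real_derivative u' t) (at t)"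
    and bound: "\<And>t. 0 < t \<Longrightarrow> t < c \<Longrightarrow> \<bar>u' t\<bar> \<le> L * \<bar>u t\<bar>"
  shows "u c = 0"
proof -
  define g where "g t = (u t)\<^sup>2 * exp (- 2 * L * t)" for t
  have "g c \<le> g 0"
  proof (rule DERIV_nonpos_imp_decreasing_open[OF \<open>0 \<le> c\<close>])
    show "continuous_on {0..c} g"
      unfolding g_def by (intro continuous_intros cont)
  next
    fix t assume t: "0 < t" "t < c"
    have d: "(g has_real_derivative 2 * (u t * u' t - L * (u t)\<^sup>2) * exp (- 2 * L * t)) (at t)"
      unfolding g_def
      by (rule derivative_eq_intros deriv[OF t] refl)+ (simp add: algebra_simps power2_eq_square)
    have "u t * u' t \<le> \<bar>u t\<bar> * \<bar>u' t\<bar>"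
      by (metis abs_ge_self abs_mult)
    also have "\<dots> \<le> \<bar>u t\<bar> * (L * \<bar>u t\<bar>)"
      using bound[OF t] by (intro mult_left_mono) auto
    also have "\<dots> = L * (u t)\<^sup>2"
      by (simp add: power2_eq_square)
    finally have "2 * (u t * u' t - L * (u t)\<^sup>2) * exp (- 2 * L * t) \<le> 0"
      by (simp add: mult_nonpos_nonneg)
    with d show "\<exists>y. (g has_real_derivative y) (at t) \<and> y \<le> 0" by blast
  qed
  hence "(u c)\<^sup>2 * exp (- 2 * L * c) \<le> 0"
    using \<open>u 0 = 0\<close> by (simp add: g_def)
  thus ?thesis
    by (simp add: mult_le_0_iff)
qed

text \<open>Continuity of a single partial derivative already gives total differentiability.\<close>

lemma has_real_derivative_diagonal:
  fixes f :: "real \<Rightarrow> real \<Rightarrow> real"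
  assumes X: "open X" "convex X" "t \<in> X"
    and fst_deriv: "((\<lambda>s. f s t) has_real_derivative a) (at t)"
    and snd_deriv: "\<And>s y. s \<in> X \<Longrightarrow> y \<in> X \<Longrightarrow> (f s has_real_derivative b s y) (at y)"
    and cont: "continuous_on (X \<times> X) (\<lambda>(s, y). b s y)"
  shows "((\<lambda>s. f s s) has_real_derivative a + b t t) (at t)"
proof -
  have "((\<lambda>(s, y). f s y) has_derivative
      (\<lambda>(ds, dy). a * ds + blinfun_scaleR_left (b t t) dy)) (at (t, t) within X \<times> X)"
  proof (rule has_derivative_partialsI[where fx = "(*) a" and fy = "\<lambda>s y. blinfun_scaleR_left (b s y)"])
    show "((\<lambda>s. f s t) has_derivative (*) a) (at t within X)"
      using fst_deriv by (auto simp: has_field_derivative_def intro: has_derivative_at_withinI)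
    show "((\<lambda>y. f s y) has_derivative blinfun_apply (blinfun_scaleR_left (b s y))) (at y within X)"
      if "s \<in> X" "y \<in> X" for s y
      using snd_deriv[OF that]
      by (auto simp: has_field_derivative_def mult.commute fun_eq_iff
          intro!: has_derivative_at_withinI elim!: has_derivative_eq_rhs)
    have "continuous_on (X \<times> X) (\<lambda>p. blinfun_scaleR_left ((\<lambda>(s, y). b s y) p))"
      by (intro bounded_linear.continuous_on[OF bounded_linear_blinfun_scaleR_left] cont)
    thus "continuous (at (t, t) within X \<times> X) (\<lambda>(s, y). blinfun_scaleR_left (b s y))"
      using X by (auto simp: continuous_on_eq_continuous_within case_prod_unfold)
  qed (use X in auto)
  hence total: "((\<lambda>(s, y). f s y) has_derivative (\<lambda>(ds, dy). a * ds + dy * b t t)) (at (t, t))"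
    using X by (simp add: at_within_open[OF _ open_Times] case_prod_unfold)
  have "((\<lambda>s. (\<lambda>(s, y). f s y) (s, s)) has_derivative (\<lambda>h. (\<lambda>(ds, dy). a * ds + dy * b t t) (h, h))) (at t)"
    by (rule has_derivative_compose[where f = "\<lambda>s. (s, s)", OF _ total]) (auto intro!: derivative_eq_intros)
  thus ?thesis
    by (auto simp: has_field_derivative_def algebra_simps elim!: has_derivative_eq_rhs)
qed

text \<open>With \<open>G x = \<integral>\<^sub>a\<^sup>x 1/K\<close> the travel time at speed \<open>K\<close>, the function \<open>G (q t)\<close> has
  derivative \<open>q' / K(q) > 1\<close>, while its values cannot exceed \<open>G b\<close>.\<close>

lemma travel_time_less:
  fixes K q :: "real \<Rightarrow> real"
  assumes K: "continuous_on {a..b} K" "\<And>x. x \<in> {a..b} \<Longrightarrow> 0 < K x"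
    and "0 < m" and cont: "continuous_on {0..m} q"
    and range: "\<And>t. t \<in> {0..m} \<Longrightarrow> q t \<in> {a..b}"
    and deriv: "\<And>t. 0 < t \<Longrightarrow> t < m \<Longrightarrow> (q has_real_derivative q' t) (at t)"
    and faster: "\<And>t. 0 < t \<Longrightarrow> t < m \<Longrightarrow> K (q t) < q' t"
  shows "m < integral {a..b} (\<lambda>x. 1 / K x)"
proof -
  define G where "G x = integral {a..x} (\<lambda>x. 1 / K x)" for x
  have contK: "continuous_on {a..b} (\<lambda>x. 1 / K x)"
    using K by (intro continuous_intros) force+
  have int: "(\<lambda>x. 1 / K x) integrable_on {c..d}" if "a \<le> c" "d \<le> b" for c d
    by (rule integrable_continuous_real, rule continuous_on_subset[OF contK]) (use that in auto)
  have G_deriv: "(G has_real_derivative 1 / K x) (at x within {a..b})" if "x \<in> {a..b}" for x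
    unfolding G_def by (rule integral_has_real_derivative[OF contK that])
  have G_cont: "continuous_on {a..b} G"
    unfolding continuous_on_eq_continuous_within using G_deriv by (blast intro: DERIV_continuous)
  have "G (q 0) - 0 < G (q m) - m"
  proof (rule DERIV_pos_imp_increasing_open[OF \<open>0 < m\<close>, where f = "\<lambda>t. G (q t) - t"])
    show "continuous_on {0..m} (\<lambda>t. G (q t) - t)"
      by (intro continuous_intros continuous_on_compose2[OF G_cont cont]) (use range in auto)
  next
    fix t assume t: "0 < t" "t < m"
    have "((G \<circ> q) has_real_derivative 1 / K (q t) * q' t) (at t within {0<..<m})"
    proof (rule DERIV_image_chain)
      show "(G has_real_derivative 1 / K (q t)) (at (q t) within q ` {0<..<m})"
        by (rule DERIV_subset[OF G_deriv]) (use range t in force)+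
      show "(q has_real_derivative q' t) (at t within {0<..<m})"
        by (rule has_field_derivative_at_within[OF deriv[OF t]])
    qed
    hence "((\<lambda>t. G (q t) - t) has_real_derivative 1 / K (q t) * q' t - 1) (at t)"
      using t by (auto simp: o_def at_within_open[of t "{0<..<m}"] intro!: derivative_intros)
    moreover have "1 / K (q t) * q' t - 1 > 0"
      using faster[OF t] K(2)[OF range, of t] t by (simp add: field_simps)
    ultimately show "\<exists>y. ((\<lambda>t. G (q t) - t) has_real_derivative y) (at t) \<and> 0 < y" by blast
  qed
  moreover have "0 \<le> G (q 0)"
    unfolding G_def using range[of 0] \<open>0 < m\<close>
    by (intro integral_nonneg int) (auto intro!: less_imp_le[OF K(2)])
  moreover have "G (q m) \<le> G b"
    unfolding G_def using range[of m] \<open>0 < m\<close>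
    by (intro integral_subset_le int) (auto intro!: less_imp_le[OF K(2)])
  ultimately show ?thesis
    by (simp add: G_def)
qed

lemma C2_bounded_derivs_lipschitz:
  assumes "C2_bounded_derivs K"
  obtains L where "\<And>x y. \<bar>K x - K y\<bar> \<le> L * \<bar>x - y\<bar>"
proof -
  obtain L where L: "\<And>x. \<bar>deriv K x\<bar> \<le> L"
    using assms by (auto simp: C2_bounded_derivs_def bounded_iff)
  have "(K has_real_derivative deriv K x) (at x)" for x
    using assms by (simp add: C2_bounded_derivs_def differentiable_on_def
        DERIV_deriv_iff_real_differentiable)
  hence "\<bar>K x - K y\<bar> \<le> L * \<bar>x - y\<bar>" for x y
    using field_differentiable_bound[of UNIV K "deriv K" L x y] L by auto
  thus ?thesis using that by blast
qed

section \<open>Classical solutions\<close>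

lemma C1_strip_tau_derivative:
  assumes "C1_strip T Q" "\<tau> \<in> time_interval T" "0 < \<tau>" "\<eta> \<in> {0..1}"
  shows "((\<lambda>s. Q s \<eta>) has_real_derivative d_tau Q \<tau> \<eta>) (at \<tau>)"
proof -
  have "((\<lambda>s. Q s \<eta>) has_real_derivative d_tau Q \<tau> \<eta>) (at \<tau> within {0..})"
    using assms unfolding C1_strip_def d_tau_def has_real_derivative_iff_has_vector_derivative
    by (intro vector_derivative_works[THEN iffD1]) blast
  moreover have "at \<tau> within {0..} = at \<tau>"
    using assms by (intro at_within_interior) auto
  ultimately show ?thesis by simp
qed

lemma C1_strip_eta_derivative:
  assumes "C1_strip T Q" "\<tau> \<in> time_interval T" "\<eta> \<in> {0<..<1}"
  shows "(Q \<tau> has_real_derivative d_eta Q \<tau> \<eta>) (at \<eta>)"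
proof -
  have "\<eta> \<in> {0..1}" using assms by auto
  hence "(Q \<tau> has_real_derivative d_eta Q \<tau> \<eta>) (at \<eta> within {0..1})"
    using assms unfolding C1_strip_def d_eta_def has_real_derivative_iff_has_vector_derivative
    by (intro vector_derivative_works[THEN iffD1]) blast
  moreover have "at \<eta> within {0..1} = at \<eta>"
    using assms by (intro at_within_interior) auto
  ultimately show ?thesis by simp
qed

lemma time_interval_downward_closed:
  assumes "\<tau> \<in> time_interval T" "0 \<le> s" "s \<le> \<tau>"
  shows "s \<in> time_interval T"
  using assms by (auto simp: time_interval_def) (meson ereal_less_eq(3) order_le_less_trans)

text \<open>The transport equation is imposed for \<open>\<eta> < 1\<close> only; letting \<open>\<eta>\<close> tend to \<open>1\<close>, the
  boundary condition for \<open>N\<close> cancels both \<open>1/N\<close> and the \<open>\<eta>\<close>-derivative.\<close>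

lemma solution_right_boundary_ode:
  assumes sol: "classical_solution K \<Phi> Q\<^sub>i T Q N" and K: "continuous_on UNIV K"
    and \<tau>: "\<tau> \<in> time_interval T" "0 < \<tau>"
  shows "d_tau Q \<tau> 1 = K (Q \<tau> 1) - K \<Phi>"
proof -
  have C1: "C1_strip T Q"
    using sol by (simp add: classical_solution_def)
  have slice: "continuous_on {0..1} (f \<tau>)"
    if "continuous_on (time_interval T \<times> {0..1}) (\<lambda>(s, y). f s y)" for f :: "real \<Rightarrow> real \<Rightarrow> real"
  proof -
    have "continuous_on {0..1} (\<lambda>\<eta>. (\<lambda>(s, y). f s y) (\<tau>, \<eta>))"
      by (rule continuous_on_compose2[OF that]) (use \<tau> in \<open>auto intro!: continuous_intros\<close>)
    thus ?thesis by simp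
  qed
  have cont: "continuous_on {0..1} (\<lambda>\<eta>. d_tau Q \<tau> \<eta> + d_eta Q \<tau> \<eta> - K (Q \<tau> \<eta>))"
    using C1 unfolding C1_strip_def
    by (intro continuous_intros slice continuous_on_compose2[OF K]) auto
  have "d_tau Q \<tau> 1 + d_eta Q \<tau> 1 - K (Q \<tau> 1) = 1 / N \<tau>"
  proof (rule continuous_constant_on_closure[where S = "{0<..<1::real}"
        and f = "\<lambda>\<eta>. d_tau Q \<tau> \<eta> + d_eta Q \<tau> \<eta> - K (Q \<tau> \<eta>)"])
    show "continuous_on (closure {0<..<1}) (\<lambda>\<eta>. d_tau Q \<tau> \<eta> + d_eta Q \<tau> \<eta> - K (Q \<tau> \<eta>))"
      using cont by simp
    show "d_tau Q \<tau> \<eta> + d_eta Q \<tau> \<eta> - K (Q \<tau> \<eta>) = 1 / N \<tau>" if "\<eta> \<in> {0<..<1}" for \<eta>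
      using sol \<tau> that by (auto simp: classical_solution_def)
  qed auto
  moreover have "1 / N \<tau> = d_eta Q \<tau> 1 - K \<Phi>"
    using sol \<tau> by (auto simp: classical_solution_def)
  ultimately show ?thesis by linarith
qed

text \<open>The constant \<open>\<Phi>\<close> is an equilibrium of the boundary equation, which has unique
  solutions because \<open>K\<close> is Lipschitz.\<close>

lemma solution_right_boundary:
  assumes sol: "classical_solution K \<Phi> Q\<^sub>i T Q N" and K: "C2_bounded_derivs K"
    and "Q\<^sub>i 1 = \<Phi>" and \<tau>: "\<tau> \<in> time_interval T"
  shows "Q \<tau> 1 = \<Phi>"
proof -
  obtain L where L: "\<And>x y. \<bar>K x - K y\<bar> \<le> L * \<bar>x - y\<bar>"
    using C2_bounded_derivs_lipschitz[OF K] by blast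
  have Kcont: "continuous_on UNIV K"
    using K by (auto simp: C2_bounded_derivs_def intro: differentiable_imp_continuous_on)
  have C1: "C1_strip T Q"
    using sol by (simp add: classical_solution_def)
  have time: "s \<in> time_interval T" if "0 \<le> s" "s \<le> \<tau>" for s
    using time_interval_downward_closed \<tau> that by blast
  have "Q \<tau> 1 - \<Phi> = 0"
  proof (rule eq_zero_if_deriv_le_linear[where u = "\<lambda>s. Q s 1 - \<Phi>" and u' = "\<lambda>s. K (Q s 1) - K \<Phi>"])
    show "0 \<le> \<tau>" using \<tau> by (simp add: time_interval_def)
    have "continuous_on (time_interval T \<times> {0..1}) (\<lambda>(s, y). Q s y)"
      using C1 by (simp add: C1_strip_def)
    hence "continuous_on {0..\<tau>} (\<lambda>s. (\<lambda>(s, y). Q s y) (s, 1))"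
      by (rule continuous_on_compose2) (use time in \<open>auto intro!: continuous_intros\<close>)
    thus "continuous_on {0..\<tau>} (\<lambda>s. Q s 1 - \<Phi>)"
      by (auto intro!: continuous_intros)
    show "Q 0 1 - \<Phi> = 0"
      using sol \<open>Q\<^sub>i 1 = \<Phi>\<close> by (simp add: classical_solution_def)
    show "((\<lambda>s. Q s 1 - \<Phi>) has_real_derivative K (Q s 1) - K \<Phi>) (at s)" if "0 < s" "s < \<tau>" for s
      using C1_strip_tau_derivative[OF C1 time, of s 1]
        solution_right_boundary_ode[OF sol Kcont time, of s] that
      by (auto intro!: derivative_eq_intros)
    show "\<bar>K (Q s 1) - K \<Phi>\<bar> \<le> L * \<bar>Q s 1 - \<Phi>\<bar>" for s by (rule L)
  qed
  thus ?thesis by simp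
qed

lemma solution_range:
  assumes sol: "classical_solution K \<Phi> Q\<^sub>i T Q N" and K: "C2_bounded_derivs K"
    and init: "Q\<^sub>i 0 = 0" "Q\<^sub>i 1 = \<Phi>" and \<tau>: "\<tau> \<in> time_interval T" and \<eta>: "\<eta> \<in> {0..1}"
  shows "Q \<tau> \<eta> \<in> {0..\<Phi>}"
proof -
  have mono: "mono_on {0..1} (Q \<tau>)"
    using sol \<tau> by (simp add: classical_solution_def)
  have "0 \<le> \<tau>" using \<tau> by (simp add: time_interval_def)
  \<comment> \<open>The boundary condition at \<open>\<eta> = 0\<close> covers positive times only; at time \<open>0\<close> the value
    comes from the initial datum.\<close>
  hence "Q \<tau> 0 = 0"
    using sol \<tau> init by (cases "\<tau> = 0") (auto simp: classical_solution_def)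
  moreover have "Q \<tau> 1 = \<Phi>"
    using solution_right_boundary[OF sol K init(2) \<tau>] .
  moreover have "Q \<tau> 0 \<le> Q \<tau> \<eta>" "Q \<tau> \<eta> \<le> Q \<tau> 1"
    using mono \<eta> by (auto intro: mono_onD)
  ultimately show ?thesis by auto
qed

lemma solution_characteristic_derivative:
  assumes sol: "classical_solution K \<Phi> Q\<^sub>i T Q N" and t: "t \<in> time_interval T" "0 < t" "t < 1"
  shows "((\<lambda>s. Q s s) has_real_derivative 1 / N t + K (Q t t)) (at t)"
proof -
  have C1: "C1_strip T Q"
    using sol by (simp add: classical_solution_def)
  \<comment> \<open>The open square of side \<open>c\<close> has \<open>(t,t)\<close> in its interior and stays within the
    solution's domain.\<close>
  obtain c where c: "t < c" "c \<le> 1" "ereal c < T"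
  proof -
    obtain r where "t < r" "ereal r < T"
      using t ereal_dense2[of "ereal t" T] by (auto simp: time_interval_def)
    hence "ereal (min r 1) < T"
      by (metis ereal_less_eq(3) min.cobounded1 order_le_less_trans)
    with \<open>t < r\<close> \<open>t < 1\<close> show ?thesis
      using that[of "min r 1"] by linarith
  qed
  have time: "s \<in> time_interval T" if "s \<in> {0<..<c}" for s
    using that c by (auto simp: time_interval_def) (meson ereal_less_eq(3) less_imp_le order_le_less_trans)
  have "((\<lambda>s. Q s s) has_real_derivative d_tau Q t t + d_eta Q t t) (at t)"
  proof (rule has_real_derivative_diagonal[where X = "{0<..<c}" and f = Q and b = "d_eta Q"])
    show "t \<in> {0<..<c}" using t c by auto
    show "((\<lambda>s. Q s t) has_real_derivative d_tau Q t t) (at t)"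
      using C1_strip_tau_derivative[OF C1, of t t] t by auto
    show "(Q s has_real_derivative d_eta Q s y) (at y)" if "s \<in> {0<..<c}" "y \<in> {0<..<c}" for s y
      using C1_strip_eta_derivative[OF C1 time, of s y] that c by auto
    have "continuous_on (time_interval T \<times> {0..1}) (\<lambda>(s, y). d_eta Q s y)"
      using C1 by (simp add: C1_strip_def)
    thus "continuous_on ({0<..<c} \<times> {0<..<c}) (\<lambda>(s, y). d_eta Q s y)"
      by (rule continuous_on_subset) (use time c in auto)
  qed auto
  moreover have "d_tau Q t t + d_eta Q t t = 1 / N t + K (Q t t)"
    using sol t by (auto simp: classical_solution_def)
  ultimately show ?thesis by simp
qed

section \<open>The bound on the existence time\<close>

text \<open>A solution defined at time \<open>m = \<integral>\<^sub>0\<^sup>\<Phi> 1/K\<close> would carry a characteristic that stays in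
  \<open>[0,\<Phi>]\<close> during \<open>[0,m]\<close> while moving strictly faster than \<open>K\<close>.  The assumption
  \<open>m \<le> 1\<close> is what keeps the characteristic inside the strip up to time \<open>m\<close>.\<close>

lemma existence_time_le:
  assumes sol: "classical_solution K \<Phi> Q\<^sub>i T Q N"
    and "0 < \<Phi>" and K: "C2_bounded_derivs K" and pos: "\<And>x. x \<in> {0..\<Phi>} \<Longrightarrow> 0 < K x"
    and m_le_1: "integral {0..\<Phi>} (\<lambda>x. 1 / K x) \<le> 1"
    and init: "Q\<^sub>i 0 = 0" "Q\<^sub>i 1 = \<Phi>"
  shows "T \<le> ereal (integral {0..\<Phi>} (\<lambda>x. 1 / K x))"
proof (rule ccontr)
  define m where "m = integral {0..\<Phi>} (\<lambda>x. 1 / K x)"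
  assume "\<not> ?thesis"
  hence "ereal m < T" by (simp add: m_def)
  have Kcont: "continuous_on {0..\<Phi>} K"
    using K by (auto simp: C2_bounded_derivs_def
        intro: differentiable_imp_continuous_on continuous_on_subset)
  have "0 < m"
  proof -
    have cont: "continuous_on {0..\<Phi>} (\<lambda>x. 1 / K x)"
      using pos by (intro continuous_intros Kcont) force
    have "0 \<le> m"
      unfolding m_def using pos
      by (intro integral_nonneg integrable_continuous_real cont) (auto simp: less_imp_le)
    moreover have "m \<noteq> 0"
      unfolding m_def using integral_eq_0_iff[OF cont \<open>0 < \<Phi>\<close>] pos[of 0] pos \<open>0 < \<Phi>\<close>
      by (force simp: less_imp_le)
    ultimately show ?thesis by simp
  qed
  have time: "s \<in> time_interval T" if "s \<in> {0..m}" for s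
    using time_interval_downward_closed[of m T s] that \<open>ereal m < T\<close> \<open>0 < m\<close>
    by (auto simp: time_interval_def)
  have "m < integral {0..\<Phi>} (\<lambda>x. 1 / K x)"
  proof (rule travel_time_less[OF Kcont pos \<open>0 < m\<close>, where q = "\<lambda>t. Q t t"])
    have "continuous_on (time_interval T \<times> {0..1}) (\<lambda>(s, y). Q s y)"
      using sol by (simp add: classical_solution_def C1_strip_def)
    hence "continuous_on {0..m} (\<lambda>t. (\<lambda>(s, y). Q s y) (t, t))"
      by (rule continuous_on_compose2) (use time m_le_1 in \<open>auto simp: m_def intro!: continuous_intros\<close>)
    thus "continuous_on {0..m} (\<lambda>t. Q t t)" by simp
    show "Q t t \<in> {0..\<Phi>}" if "t \<in> {0..m}" for t
      using solution_range[OF sol K init time[OF that], of t] that m_le_1 by (auto simp: m_def)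
    show "((\<lambda>t. Q t t) has_real_derivative 1 / N t + K (Q t t)) (at t)" if "0 < t" "t < m" for t
      using solution_characteristic_derivative[OF sol time, of t] that m_le_1 by (auto simp: m_def)
    show "K (Q t t) < 1 / N t + K (Q t t)" if "0 < t" "t < m" for t
      using sol time[of t] that by (auto simp: classical_solution_def)
  qed
  thus False by (simp add: m_def)
qed

theorem theorem6p2:
  fixes K :: "real \<Rightarrow> real" and \<Phi>\<^sub>F :: real and Q\<^sub>i :: "real \<Rightarrow> real"
    and T :: ereal and Q :: "real \<Rightarrow> real \<Rightarrow> real" and N :: "real \<Rightarrow> real"
  assumes "\<Phi>\<^sub>F > 0"
    and "C2_bounded_derivs K"
    and "\<forall>\<phi>\<in>{0..\<Phi>\<^sub>F}. K \<phi> > 0"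
    and "integral {0..\<Phi>\<^sub>F} (\<lambda>\<phi>. 1 / K \<phi>) \<le> 1"
    and "initial_datum K \<Phi>\<^sub>F Q\<^sub>i"
    and "classical_solution K \<Phi>\<^sub>F Q\<^sub>i T Q N"
  shows "blows_up_in_finite_time K \<Phi>\<^sub>F Q\<^sub>i \<and>
     max_existence_time K \<Phi>\<^sub>F Q\<^sub>i \<le> ereal (integral {0..\<Phi>\<^sub>F} (\<lambda>\<phi>. 1 / K \<phi>)) \<and>
     ereal (integral {0..\<Phi>\<^sub>F} (\<lambda>\<phi>. 1 / K \<phi>)) \<le> 1 \<and> (1::ereal) < \<infinity>"
proof -
  have init: "Q\<^sub>i 0 = 0" "Q\<^sub>i 1 = \<Phi>\<^sub>F"
    using assms(5) by (simp_all add: initial_datum_def)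
  have le: "max_existence_time K \<Phi>\<^sub>F Q\<^sub>i \<le> ereal (integral {0..\<Phi>\<^sub>F} (\<lambda>\<phi>. 1 / K \<phi>))"
    unfolding max_existence_time_def
    using existence_time_le[OF _ assms(1,2) _ assms(4) init] assms(3)
    by (intro Sup_least) blast
  also have "\<dots> < \<infinity>" by simp
  finally show ?thesis
    using le assms(4) by (simp add: blows_up_in_finite_time_def)
qed

end
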